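(* Let $P_X$ and $P_Y$ be two probability distributions on $\{-1,1\}$ such that $P_X(1),P_Y(1)\notin\{0,1\}$, and let $\mathcal{U}=\mathcal{V}=\{-1,1\}$. Then $$\mathcal{P}_{CR}(P_XP_Y,\mathcal{U},\mathcal{V})=\bigcup_{a,b\in[0,1]}\Big\{Q_{U,V}\ \Big|\ Q_U(1)=a,\ Q_V(1)=b,\ |Q_{U,V}(-1,-1)+Q_{U,V}(1,1)-\zeta_{a,b}|\le 2\beta_{a,b}\Big\},$$ where $Q_{U,V}$ ranges over probability distributions on $\{-1,1\}^2$ with marginals $Q_U,Q_V$, and for $a,b\in[0,1]$, $$\zeta_{a,b}=2ab-a-b+1,\qquad \beta_{a,b}=\min\{a,1-a\}\,\min\{b,1-b\}.$$
   Context: $P_XP_Y$ denotes the product distribution on $\{-1,1\}^2$. A stochastic function is a function whose output may also depend on private randomness, independent of everything else (in particular, the private randomness of Alice and that of Bob are independent); equivalently, a Markov kernel from inputs to outputs. $d_{TV}$ is total variation distance. Common-randomness simulation (CR-NISS). For a distribution $P_{X,Y}$ on $\{-1,1\}^2$ and finite sets $\mathcal{U},\mathcal{V}$, $\mathcal{P}_{CR}(P_{X,Y},\mathcal{U},\mathcal{V})$ is the set of distributions $Q_{U,V}$ on $\mathcal{U}\times\mathcal{V}$ for which there exist, for each $d\in\mathbb{N}$, (possibly stochastic) functions $f_d:\{-1,1\}^{d+1}\to\mathcal{U}$ and $g_d:\{-1,1\}^{d+1}\to\mathcal{V}$ such that the law $P^{(d)}$ of $(f_d(Z,X^d),g_d(Z,Y^d))$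 satisfies $\lim_{d\to\infty}d_{TV}(P^{(d)},Q_{U,V})=0$, where $(X^d,Y^d)=((X_1,Y_1),\dots,(X_d,Y_d))$ is i.i.d. with law $P_{X,Y}$, and $Z$ is uniform on $\{-1,1\}$ and independent of $(X^d,Y^d)$. *)

theory Defs
  imports "HOL-Probability.Probability"
begin

definition d_TV :: "'a pmf \<Rightarrow> 'a pmf \<Rightarrow> real" where
  "d_TV P Q = (SUP A. \<bar>measure_pmf.prob P A - measure_pmf.prob Q A\<bar>)"

(* A stochastic function is a Markov kernel on its domain A; outside A its value is irrelevant. *)
definition stochastic_function :: "'a set \<Rightarrow> 'b set \<Rightarrow> ('a \<Rightarrow> 'b pmf) \<Rightarrow> bool" where
  "stochastic_function A B f \<longleftrightarrow> (\<forall>x\<in>A. set_pmf (f x) \<subseteq> B)"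

definition sign_strings :: "nat \<Rightarrow> int list set" where
  "sign_strings n = {xs. length xs = n \<and> set xs \<subseteq> {-1, 1}}"

(* Law of (f(Z, X^d), g(Z, Y^d)), where Z is uniform on {-1, 1} and independent of the d i.i.d.
   samples (X_i, Y_i) of P. The outputs are drawn from the kernels independently of each other,
   given the inputs, since the private randomness of the two parties is independent. *)
definition cr_output ::
  "(int \<times> int) pmf \<Rightarrow> nat \<Rightarrow> (int list \<Rightarrow> 'u pmf) \<Rightarrow> (int list \<Rightarrow> 'v pmf) \<Rightarrow> ('u \<times> 'v) pmf" where
  "cr_output P d f g =
     do {
       z \<leftarrow> pmf_of_set {-1, 1};
       xys \<leftarrow> replicate_pmf d P;
       pair_pmf (f (z # map fst xys)) (g (z # map snd xys))
     }"

definition P_CR :: "(int \<times> int) pmf \<Rightarrow> 'u set \<Rightarrow> 'v set \<Rightarrow> ('u \<times> 'v) pmf set" where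
  "P_CR P U V = {Q. set_pmf Q \<subseteq> U \<times> V \<and>
     (\<exists>f g. (\<forall>d. stochastic_function (sign_strings (d + 1)) U (f d)) \<and>
            (\<forall>d. stochastic_function (sign_strings (d + 1)) V (g d)) \<and>
            (\<lambda>d. d_TV (cr_output P d (f d) (g d)) Q) \<longlonglongrightarrow> 0)}"

definition zeta :: "real \<Rightarrow> real \<Rightarrow> real" where
  "zeta a b = 2 * a * b - a - b + 1"

definition beta :: "real \<Rightarrow> real \<Rightarrow> real" where
  "beta a b = min a (1 - a) * min b (1 - b)"

end

theory Submission
  imports Defs
begin

text \<open>
  As \<open>X\<^sup>d\<close> and \<open>Y\<^sup>d\<close> are independent, the outputs are independent given \<open>Z\<close>: their law is an
  equal-weight mixture of two product laws. Writing the success probabilities of the two components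
  as \<open>a \<plusminus> \<delta>\<close> and \<open>b \<plusminus> \<epsilon>\<close>, the covariance \<open>Q(1,1) - a b\<close> is \<open>\<delta> \<epsilon>\<close>, where
  \<open>\<bar>\<delta>\<bar> \<le> min a (1 - a)\<close> and \<open>\<bar>\<epsilon>\<bar> \<le> min b (1 - b)\<close>, and every such \<open>\<delta>\<close> and \<open>\<epsilon>\<close> is attained with
  private randomness alone. Since \<open>Q(-1,-1) + Q(1,1) - \<zeta>\<close> is twice the covariance, the mixtures
  satisfy the claimed inequality, which is a closed condition.
\<close>

section \<open>Total variation distance and convergence of atoms\<close>

lemma bdd_above_prob_diff:
  "bdd_above (range (\<lambda>A. \<bar>measure_pmf.prob P A - measure_pmf.prob Q A\<bar>))"
proof (rule bdd_aboveI2)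
  fix A
  have "0 \<le> measure_pmf.prob P A" "measure_pmf.prob P A \<le> 1"
    "0 \<le> measure_pmf.prob Q A" "measure_pmf.prob Q A \<le> 1"
    by simp_all
  then show "\<bar>measure_pmf.prob P A - measure_pmf.prob Q A\<bar> \<le> 1"
    by linarith
qed

text \<open>The singleton of \<open>x\<close> is one of the events in the supremum, which dominates
  it because the family is bounded.\<close>

lemma pmf_diff_le_d_TV: "\<bar>pmf P x - pmf Q x\<bar> \<le> d_TV P Q"
  using cSUP_upper[OF UNIV_I[of "{x}"] bdd_above_prob_diff[of P Q]]
  by (simp add: d_TV_def measure_pmf_single)

lemma d_TV_self: "d_TV P P = 0"
  by (simp add: d_TV_def)

lemma tendsto_pmf_if_d_TV:
  assumes "(\<lambda>d. d_TV (P d) Q) \<longlonglongrightarrow> 0"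
  shows "(\<lambda>d. pmf (P d) x) \<longlonglongrightarrow> pmf Q x"
proof -
  have "(\<lambda>d. pmf (P d) x - pmf Q x) \<longlonglongrightarrow> 0"
    by (rule Lim_null_comparison[OF _ assms]) (simp add: pmf_diff_le_d_TV)
  then show ?thesis
    by (simp add: LIM_zero_iff)
qed

section \<open>Factorization of the output law given the common bit\<close>

lemma bind_pair_pmf: "bind_pmf (pair_pmf A B) h = bind_pmf A (\<lambda>x. bind_pmf B (\<lambda>y. h (x, y)))"
  by (simp add: pair_pmf_def bind_assoc_pmf bind_return_pmf)

lemma pair_bind_pmf:
  "pair_pmf (bind_pmf A F) (bind_pmf B G) =
    bind_pmf A (\<lambda>x. bind_pmf B (\<lambda>y. pair_pmf (F x) (G y)))"
  unfolding pair_pmf_def bind_assoc_pmf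
  \<comment> \<open>The two sides differ only in the order of the independent draws from
    \<open>F x\<close> and \<open>B\<close>.\<close>
  by (subst (2) bind_commute_pmf) (rule refl)

text \<open>Independence within each pair lets all first coordinates be drawn before all second
  ones. The continuation \<open>h\<close> is generalized because the induction step prepends the
  first pair to its arguments.\<close>

lemma bind_replicate_pair_pmf:
  "bind_pmf (replicate_pmf d (pair_pmf A B)) (\<lambda>xys. h (map fst xys) (map snd xys)) =
    bind_pmf (replicate_pmf d A) (\<lambda>xs. bind_pmf (replicate_pmf d B) (\<lambda>ys. h xs ys))"
proof (induction d arbitrary: h)
  case 0
  then show ?case by (simp add: bind_return_pmf)
next
  case (Suc d)
  have "bind_pmf (replicate_pmf (Suc d) (pair_pmf A B)) (\<lambda>xys. h (map fst xys) (map snd xys)) =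
    bind_pmf A (\<lambda>x. bind_pmf B (\<lambda>y. bind_pmf (replicate_pmf d (pair_pmf A B))
      (\<lambda>xys. h (x # map fst xys) (y # map snd xys))))"
    by (simp add: bind_assoc_pmf bind_return_pmf bind_pair_pmf)
  also have "\<dots> = bind_pmf A (\<lambda>x. bind_pmf B (\<lambda>y. bind_pmf (replicate_pmf d A)
      (\<lambda>xs. bind_pmf (replicate_pmf d B) (\<lambda>ys. h (x # xs) (y # ys)))))"
    by (simp add: Suc.IH[of "\<lambda>xs ys. h (_ # xs) (_ # ys)"])
  also have "\<dots> = bind_pmf (replicate_pmf (Suc d) A)
      (\<lambda>xs. bind_pmf (replicate_pmf (Suc d) B) (\<lambda>ys. h xs ys))"
    by (simp add: bind_assoc_pmf bind_return_pmf bind_commute_pmf[of B "replicate_pmf d A"])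
  finally show ?case .
qed

lemma cr_output_pair_pmf:
  "cr_output (pair_pmf A B) d f g =
    bind_pmf (pmf_of_set {-1, 1}) (\<lambda>z. pair_pmf
      (bind_pmf (replicate_pmf d A) (\<lambda>xs. f (z # xs)))
      (bind_pmf (replicate_pmf d B) (\<lambda>ys. g (z # ys))))"
  unfolding cr_output_def pair_bind_pmf
  by (simp add: bind_replicate_pair_pmf[of _ _ _ "\<lambda>xs ys. pair_pmf (f (_ # xs)) (g (_ # ys))"])

lemma set_bind_replicate_pmf_subset:
  assumes f: "stochastic_function (sign_strings (d + 1)) U f"
    and P: "set_pmf P \<subseteq> {-1, 1}" and z: "z \<in> {-1, 1}"
  shows "set_pmf (bind_pmf (replicate_pmf d P) (\<lambda>xs. f (z # xs))) \<subseteq> U"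
proof -
  have "z # xs \<in> sign_strings (d + 1)" if "xs \<in> set_pmf (replicate_pmf d P)" for xs
    using that P z by (fastforce simp: set_replicate_pmf sign_strings_def)
  then show ?thesis
    using f by (auto simp: stochastic_function_def)
qed


section \<open>Laws on pairs of signs and the covariance condition\<close>

lemma pmf_sign_pairs:
  assumes "set_pmf Q \<subseteq> {-1, 1} \<times> {-1, 1 :: int}"
  shows "pmf (map_pmf fst Q) (1 :: int) = pmf Q (1, 1) + pmf Q (1, -1)"
    and "pmf (map_pmf snd Q) 1 = pmf Q (1, 1) + pmf Q (-1, 1)"
    and "pmf Q (1, 1) + pmf Q (1, -1) + pmf Q (-1, 1) + pmf Q (-1, -1) = 1"
proof -
  \<comment> \<open>Only the trace of an event on the four sign pairs matters, so the infinite
    preimages under \<open>fst\<close> and \<open>snd\<close> reduce to two-point sets.\<close>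
  have prob: "measure_pmf.prob Q A = measure_pmf.prob Q B"
    if "A \<inter> ({-1, 1} \<times> {-1, 1}) = B \<inter> ({-1, 1} \<times> {-1, 1})" for A B
    using that assms by (intro measure_pmf.finite_measure_eq_AE AE_pmfI) auto
  have "measure_pmf.prob Q (fst -` {1}) = measure_pmf.prob Q {(1, 1), (1, -1)}"
    by (rule prob) auto
  then show "pmf (map_pmf fst Q) 1 = pmf Q (1, 1) + pmf Q (1, -1)"
    by (simp add: pmf_map measure_measure_pmf_finite)
  have "measure_pmf.prob Q (snd -` {1}) = measure_pmf.prob Q {(1, 1), (-1, 1)}"
    by (rule prob) auto
  then show "pmf (map_pmf snd Q) 1 = pmf Q (1, 1) + pmf Q (-1, 1)"
    by (simp add: pmf_map measure_measure_pmf_finite)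
  show "pmf Q (1, 1) + pmf Q (1, -1) + pmf Q (-1, 1) + pmf Q (-1, -1) = 1"
    using sum_pmf_eq_1[OF _ assms] by (simp add: insert_Times_insert)
qed

text \<open>Both marginals, the atom at \<open>(1, 1)\<close> and total mass 1 determine the other
  three atoms linearly.\<close>

lemma pmf_sign_pairs_eqI:
  assumes Q: "set_pmf Q \<subseteq> {-1, 1} \<times> {-1, 1 :: int}"
    and R: "set_pmf R \<subseteq> {-1, 1} \<times> {-1, 1 :: int}"
    and "pmf (map_pmf fst Q) 1 = pmf (map_pmf fst R) (1 :: int)"
    and "pmf (map_pmf snd Q) 1 = pmf (map_pmf snd R) 1"
    and "pmf Q (1, 1) = pmf R (1, 1)"
  shows "Q = R"
proof (rule pmf_eqI)
  fix xy :: "int \<times> int"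
  show "pmf Q xy = pmf R xy"
  proof (cases "xy \<in> {-1, 1} \<times> {-1, 1}")
    case True
    then show ?thesis
      using assms(3-) pmf_sign_pairs[OF Q] pmf_sign_pairs[OF R] by auto
  next
    case False
    then have "xy \<notin> set_pmf Q" "xy \<notin> set_pmf R"
      using Q R by auto
    then show ?thesis
      by (simp add: set_pmf_iff)
  qed
qed

text \<open>The quantity inside the absolute value is the covariance of the indicators of U = 1 and
  V = 1. The parameters a and b are read off from \<open>Q\<close>, which makes this a condition on
  \<open>Q\<close> alone.\<close>

definition covariance_bounded :: "(int \<times> int) pmf \<Rightarrow> bool" where
  "covariance_bounded Q \<longleftrightarrow>
    \<bar>pmf Q (1, 1) - pmf (map_pmf fst Q) 1 * pmf (map_pmf snd Q) 1\<bar> \<le>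
      beta (pmf (map_pmf fst Q) 1) (pmf (map_pmf snd Q) 1)"

lemma covariance_bounded_iff_zeta:
  assumes "set_pmf Q \<subseteq> {-1, 1} \<times> {-1, 1}"
    and a: "pmf (map_pmf fst Q) 1 = a" and b: "pmf (map_pmf snd Q) 1 = b"
  shows "\<bar>pmf Q (-1, -1) + pmf Q (1, 1) - zeta a b\<bar> \<le> 2 * beta a b \<longleftrightarrow> covariance_bounded Q"
proof -
  have "pmf Q (-1, -1) + pmf Q (1, 1) - zeta a b = 2 * (pmf Q (1, 1) - a * b)"
    using pmf_sign_pairs[OF assms(1)] a b by (simp add: zeta_def algebra_simps)
  then show ?thesis
    unfolding covariance_bounded_def a b by (simp only: abs_mult) simp
qed

section \<open>Necessity: mixtures of two product laws and their limits\<close>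

lemma map_pmf_bind_pair_pmf:
  "map_pmf fst (bind_pmf M (\<lambda>z. pair_pmf (F z) (G z))) = bind_pmf M F"
  "map_pmf snd (bind_pmf M (\<lambda>z. pair_pmf (F z) (G z))) = bind_pmf M G"
  by (simp_all add: map_bind_pmf map_fst_pair_pmf map_snd_pair_pmf)

lemma pmf_bind_sign:
  "pmf (bind_pmf (pmf_of_set {-1, 1 :: int}) H) x = (pmf (H 1) x + pmf (H (-1)) x) / 2"
  by (simp add: pmf_bind integral_pmf_of_set)

text \<open>The covariance of an equal-weight mixture of two product laws is the product of the
  half-differences of the success probabilities, and each half-difference is bounded
  separately.\<close>

lemma covariance_bounded_mixture:
  "covariance_bounded (bind_pmf (pmf_of_set {-1, 1 :: int}) (\<lambda>z. pair_pmf (F z) (G z)))"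
proof -
  let ?M = "bind_pmf (pmf_of_set {-1, 1 :: int}) (\<lambda>z. pair_pmf (F z) (G z))"
  define p q p' q' where "p = pmf (F 1) 1" and "q = pmf (G 1) 1"
    and "p' = pmf (F (-1)) 1" and "q' = pmf (G (-1)) 1"
  define m where "m r s = min ((r + s) / 2) (1 - (r + s) / 2)" for r s :: real
  \<comment> \<open>The mean plus or minus the half-difference gives back \<open>r\<close> and
    \<open>s\<close>, which lie in [0, 1]; hence the half-difference is at most the distance from
    the mean to the nearer endpoint.\<close>
  have half_diff: "\<bar>(r - s) / 2\<bar> \<le> m r s" if "0 \<le> r" "r \<le> 1" "0 \<le> s" "s \<le> 1" for r s
    using that unfolding m_def by (simp add: abs_if min_def field_simps)
  have "\<bar>(p - p') / 2 * ((q - q') / 2)\<bar> \<le> m p p' * m q q'"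
    unfolding abs_mult using half_diff[of p p'] half_diff[of q q']
    by (intro mult_mono') (simp_all add: p_def q_def p'_def q'_def pmf_le_1)
  also have "(p - p') / 2 * ((q - q') / 2) = (p * q + p' * q') / 2
      - (p + p') / 2 * ((q + q') / 2)"
    by (simp add: field_simps)
  finally have "\<bar>(p * q + p' * q') / 2 - (p + p') / 2 * ((q + q') / 2)\<bar> \<le> m p p' * m q q'" .
  moreover have "pmf ?M (1, 1) = (p * q + p' * q') / 2"
    and "pmf (map_pmf fst ?M) 1 = (p + p') / 2"
    and "pmf (map_pmf snd ?M) 1 = (q + q') / 2"
    by (simp_all add: map_pmf_bind_pair_pmf pmf_bind_sign pmf_pair p_def q_def p'_def q'_def)
  ultimately show ?thesis
    by (simp only: covariance_bounded_def beta_def m_def)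
qed

text \<open>Both sides of the inequality are continuous in the atoms: marginals are sums of two
  atoms, and \<open>beta\<close> is built from minima and products.\<close>

lemma covariance_bounded_limit:
  assumes supp: "\<And>d. set_pmf (P d) \<subseteq> {-1, 1} \<times> {-1, 1}" "set_pmf Q \<subseteq> {-1, 1} \<times> {-1, 1}"
    and bounded: "\<And>d. covariance_bounded (P d)"
    and lim: "(\<lambda>d. d_TV (P d) Q) \<longlonglongrightarrow> 0"
  shows "covariance_bounded Q"
proof -
  note pmf_lim = tendsto_pmf_if_d_TV[OF lim]
  have fst_lim: "(\<lambda>d. pmf (map_pmf fst (P d)) 1) \<longlonglongrightarrow> pmf (map_pmf fst Q) 1"
    unfolding pmf_sign_pairs[OF supp(1)] pmf_sign_pairs[OF supp(2)]
    by (intro tendsto_add pmf_lim)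
  have snd_lim: "(\<lambda>d. pmf (map_pmf snd (P d)) 1) \<longlonglongrightarrow> pmf (map_pmf snd Q) 1"
    unfolding pmf_sign_pairs[OF supp(1)] pmf_sign_pairs[OF supp(2)]
    by (intro tendsto_add pmf_lim)
  show ?thesis
    unfolding covariance_bounded_def
  proof (rule tendsto_le[OF sequentially_bot])
    show "(\<lambda>d. beta (pmf (map_pmf fst (P d)) 1) (pmf (map_pmf snd (P d)) 1))
        \<longlonglongrightarrow> beta (pmf (map_pmf fst Q) 1) (pmf (map_pmf snd Q) 1)"
      unfolding beta_def by (intro tendsto_intros tendsto_min fst_lim snd_lim)
    show "(\<lambda>d. \<bar>pmf (P d) (1, 1) - pmf (map_pmf fst (P d)) 1 * pmf (map_pmf snd (P d)) 1\<bar>)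
        \<longlonglongrightarrow> \<bar>pmf Q (1, 1) - pmf (map_pmf fst Q) 1 * pmf (map_pmf snd Q) 1\<bar>"
      by (intro tendsto_intros pmf_lim fst_lim snd_lim)
    show "\<forall>\<^sub>F d in sequentially.
        \<bar>pmf (P d) (1, 1) - pmf (map_pmf fst (P d)) 1 * pmf (map_pmf snd (P d)) 1\<bar>
          \<le> beta (pmf (map_pmf fst (P d)) 1) (pmf (map_pmf snd (P d)) 1)"
      using bounded by (simp add: covariance_bounded_def)
  qed
qed

section \<open>Sufficiency: realizing a given covariance by private coins\<close>

definition sign_pmf :: "real \<Rightarrow> int pmf" where
  "sign_pmf p = map_pmf (\<lambda>t. if t then 1 else -1) (bernoulli_pmf p)"

lemma set_sign_pmf: "set_pmf (sign_pmf p) \<subseteq> {-1, 1}"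
  by (auto simp: sign_pmf_def)

lemma pmf_sign_pmf:
  assumes "0 \<le> p" "p \<le> 1"
  shows "pmf (sign_pmf p) 1 = p"
proof -
  have "(\<lambda>t. if t then 1 else - 1) -` {1 :: int} = {True}"
    by (auto split: if_splits)
  then show ?thesis
    using assms by (simp add: sign_pmf_def pmf_map measure_pmf_single)
qed

text \<open>Fixing one factor at its extreme value \<open>m\<close> leaves \<open>e = c / m\<close>;
  if \<open>m = 0\<close>, then \<open>c = 0\<close> and \<open>e = 0\<close> works.\<close>

lemma factor_in_box:
  fixes c m n :: real
  assumes "\<bar>c\<bar> \<le> m * n" "0 \<le> m" "0 \<le> n"
  obtains e where "c = m * e" "\<bar>e\<bar> \<le> n"
proof (cases "m = 0")
  case True
  then show ?thesis using that[of 0] assms by simp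
next
  case False
  then show ?thesis using that[of "c / m"] assms by (simp add: abs_divide field_simps)
qed

lemma covariance_bounded_obtains_mixture:
  assumes supp: "set_pmf Q \<subseteq> {-1, 1} \<times> {-1, 1}" and bounded: "covariance_bounded Q"
  obtains p q :: "int \<Rightarrow> real"
  where "Q = bind_pmf (pmf_of_set {-1, 1}) (\<lambda>z. pair_pmf (sign_pmf (p z)) (sign_pmf (q z)))"
proof -
  define a b where "a = pmf (map_pmf fst Q) 1" and "b = pmf (map_pmf snd Q) 1"
  define m n where "m = min a (1 - a)" and "n = min b (1 - b)"
  have mn: "0 \<le> m" "0 \<le> n"
    by (simp_all add: m_def n_def a_def b_def pmf_le_1)
  have "\<bar>pmf Q (1, 1) - a * b\<bar> \<le> m * n"
    using bounded by (simp add: covariance_bounded_def beta_def m_def n_def a_def b_def)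
  then obtain e where e: "pmf Q (1, 1) - a * b = m * e" "\<bar>e\<bar> \<le> n"
    using mn by (rule factor_in_box)
  \<comment> \<open>Opposite shifts for the two values of \<open>z\<close> preserve the marginals
    \<open>a\<close> and \<open>b\<close>, and the product \<open>m * e\<close> of the shifts is the
    covariance. The bounds on \<open>m\<close> and \<open>e\<close> keep all four parameters in
    [0, 1].\<close>
  define p q where "p z = a + of_int z * m" and "q z = b + of_int z * e" for z :: int
  have bounds: "0 \<le> p 1" "p 1 \<le> 1" "0 \<le> p (-1)" "p (-1) \<le> 1"
      "0 \<le> q 1" "q 1 \<le> 1" "0 \<le> q (-1)" "q (-1) \<le> 1"
    using mn e(2) unfolding p_def q_def m_def n_def by auto
  have "Q = bind_pmf (pmf_of_set {-1, 1}) (\<lambda>z. pair_pmf (sign_pmf (p z)) (sign_pmf (q z)))"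
    (is "Q = ?M")
  proof (rule pmf_sign_pairs_eqI[OF supp])
    show "set_pmf ?M \<subseteq> {-1, 1} \<times> {-1, 1}"
      using set_sign_pmf by (auto simp: subset_iff)
    show "pmf (map_pmf fst Q) 1 = pmf (map_pmf fst ?M) 1"
      by (simp add: map_pmf_bind_pair_pmf pmf_bind_sign pmf_sign_pmf bounds)
        (simp add: p_def a_def)
    show "pmf (map_pmf snd Q) 1 = pmf (map_pmf snd ?M) 1"
      by (simp add: map_pmf_bind_pair_pmf pmf_bind_sign pmf_sign_pmf bounds)
        (simp add: q_def b_def)
    have "pmf ?M (1, 1) = a * b + m * e"
      by (simp add: pmf_bind_sign pmf_pair pmf_sign_pmf bounds)
        (simp add: p_def q_def field_simps)
    then show "pmf Q (1, 1) = pmf ?M (1, 1)"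
      using e(1) by simp
  qed
  then show ?thesis by (rule that)
qed

section \<open>Characterization of the simulable laws\<close>

lemma P_CR_pair_pmf:
  assumes "set_pmf P_X \<subseteq> {-1, 1}" and "set_pmf P_Y \<subseteq> {-1, 1}"
  shows "P_CR (pair_pmf P_X P_Y) {-1, 1} {-1, 1} =
    {Q. set_pmf Q \<subseteq> {-1, 1} \<times> {-1, 1} \<and> covariance_bounded Q}"
proof (intro set_eqI iffI)
  fix Q :: "(int \<times> int) pmf"
  assume "Q \<in> P_CR (pair_pmf P_X P_Y) {-1, 1} {-1, 1}"
  then obtain f g where Q: "set_pmf Q \<subseteq> {-1, 1} \<times> {-1, 1}"
    and f: "\<And>d. stochastic_function (sign_strings (d + 1)) {-1, 1} (f d)"
    and g: "\<And>d. stochastic_function (sign_strings (d + 1)) {-1, 1} (g d)"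
    and lim: "(\<lambda>d. d_TV (cr_output (pair_pmf P_X P_Y) d (f d) (g d)) Q) \<longlonglongrightarrow> 0"
    unfolding P_CR_def by blast
  note kernels = set_bind_replicate_pmf_subset[OF f assms(1)]
    set_bind_replicate_pmf_subset[OF g assms(2)]
  have "covariance_bounded Q"
  proof (rule covariance_bounded_limit[OF _ Q _ lim])
    fix d
    show "covariance_bounded (cr_output (pair_pmf P_X P_Y) d (f d) (g d))"
      unfolding cr_output_pair_pmf by (rule covariance_bounded_mixture)
    show "set_pmf (cr_output (pair_pmf P_X P_Y) d (f d) (g d)) \<subseteq> {-1, 1} \<times> {-1, 1}"
      unfolding cr_output_pair_pmf set_bind_pmf[of "pmf_of_set _"] set_pair_pmf
      by (intro UN_least Sigma_mono; rule kernels) simp_all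
  qed
  with Q show "Q \<in> {Q. set_pmf Q \<subseteq> {-1, 1} \<times> {-1, 1} \<and> covariance_bounded Q}"
    by simp
next
  fix Q :: "(int \<times> int) pmf"
  assume "Q \<in> {Q. set_pmf Q \<subseteq> {-1, 1} \<times> {-1, 1} \<and> covariance_bounded Q}"
  then have Q: "set_pmf Q \<subseteq> {-1, 1} \<times> {-1, 1}" and bounded: "covariance_bounded Q"
    by auto
  obtain p q :: "int \<Rightarrow> real" where
    M: "Q = bind_pmf (pmf_of_set {-1, 1}) (\<lambda>z. pair_pmf (sign_pmf (p z)) (sign_pmf (q z)))"
    by (rule covariance_bounded_obtains_mixture[OF Q bounded])
  \<comment> \<open>The head of the input is the common bit; the samples are ignored. The output law
    then equals \<open>Q\<close> exactly for every \<open>d\<close>, including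
    \<open>d = 0\<close>.\<close>
  define f where "f = (\<lambda>r (d :: nat) (zs :: int list). sign_pmf (r (hd zs)))"
  \<comment> \<open>\<open>sign_pmf\<close> is supported on the signs for every real parameter, so
    \<open>r\<close> can be arbitrary.\<close>
  have "stochastic_function (sign_strings (d + 1)) {-1, 1} (f r d)" for r d
    unfolding stochastic_function_def f_def using set_sign_pmf by blast
  moreover have "cr_output (pair_pmf P_X P_Y) d (f p d) (f q d) = Q" for d
    unfolding cr_output_pair_pmf M f_def by simp
  then have "(\<lambda>d. d_TV (cr_output (pair_pmf P_X P_Y) d (f p d) (f q d)) Q) \<longlonglongrightarrow> 0"
    by (simp add: d_TV_self)
  ultimately show "Q \<in> P_CR (pair_pmf P_X P_Y) {-1, 1} {-1, 1}"
    using Q unfolding P_CR_def by blast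
qed

theorem proposition2:
  fixes P_X P_Y :: "int pmf"
  assumes "set_pmf P_X \<subseteq> {-1, 1}" and "set_pmf P_Y \<subseteq> {-1, 1}"
    and "pmf P_X 1 \<notin> {0, 1}" and "pmf P_Y 1 \<notin> {0, 1}"
  shows "P_CR (pair_pmf P_X P_Y) {-1, 1 :: int} {-1, 1 :: int} =
    (\<Union>a\<in>{0..1}. \<Union>b\<in>{0..1}.
      {Q. set_pmf Q \<subseteq> {-1, 1} \<times> {-1, 1} \<and>
          pmf (map_pmf fst Q) 1 = a \<and> pmf (map_pmf snd Q) 1 = b \<and>
          \<bar>pmf Q (-1, -1) + pmf Q (1, 1) - zeta a b\<bar> \<le> 2 * beta a b})"
  unfolding P_CR_pair_pmf[OF assms(1,2)]
  \<comment> \<open>The union over \<open>a\<close> and \<open>b\<close> collapses: each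
    \<open>Q\<close> occurs only for its own marginals, which are probabilities and so lie in
    [0, 1].\<close>
  using covariance_bounded_iff_zeta by (auto simp: pmf_le_1)

end
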